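(* Let $D$ be an integral domain with quotient field $K$, let $B$ be an integral domain containing $D$ as a subring, and let $E$ be a nonempty subset of $K$. The $D$-module $\mathrm{Int}^{\mathrm R}(E,D)$ is flat if and only if it is faithfully flat. Likewise, the $D$-module $\mathrm{Int}_B(E,D)$ is flat if and only if it is faithfully flat.
   Context: $\mathrm{Int}^{\mathrm R}(E,D):=\{f\in K(X);\ f(E)\subseteq D\}$, where $f(E)\subseteq D$ means that for every $e\in E$ the rational function $f$ is defined at $e$ and $f(e)\in D$. $\mathrm{Int}_B(E,D):=\{f\in B[X];\ f(E)\subseteq D\}$, where elements of $E\subseteq K$ are evaluated in the quotient field of $B$, which contains $K$. *)

theory Defs
  imports
    "HOL-Algebra.Free_Abelian_Groups"
    "HOL-Algebra.Algebraic_Closure_Type"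
    "HOL-Computational_Algebra.Polynomial_Factorial"
begin

section \<open>Tensor products, flatness and faithful flatness\<close>

text \<open>
  The tensor product of two modules over a commutative ring is the free abelian group on the
  pairs modulo the subgroup generated by the bilinearity relations. The scalar action on it is
  not recorded: exactness of a sequence only depends on the underlying abelian groups.
\<close>

definition tensor_relations ::
  "('r, 'a) ring_scheme \<Rightarrow> ('r, 'm, 'b) module_scheme \<Rightarrow> ('r, 'n, 'c) module_scheme
     \<Rightarrow> (('m \<times> 'n) \<Rightarrow>\<^sub>0 int) set"
  where "tensor_relations R M N =
      {frag_of (x \<oplus>\<^bsub>M\<^esub> x', y) - frag_of (x, y) - frag_of (x', y) | x x' y.
         x \<in> carrier M \<and> x' \<in> carrier M \<and> y \<in> carrier N}
    \<union> {frag_of (x, y \<oplus>\<^bsub>N\<^esub> y') - frag_of (x, y) - frag_of (x, y') | x y y'.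
         x \<in> carrier M \<and> y \<in> carrier N \<and> y' \<in> carrier N}
    \<union> {frag_of (r \<odot>\<^bsub>M\<^esub> x, y) - frag_of (x, r \<odot>\<^bsub>N\<^esub> y) | r x y.
         r \<in> carrier R \<and> x \<in> carrier M \<and> y \<in> carrier N}"

definition tensor_kernel ::
  "('r, 'a) ring_scheme \<Rightarrow> ('r, 'm, 'b) module_scheme \<Rightarrow> ('r, 'n, 'c) module_scheme
     \<Rightarrow> (('m \<times> 'n) \<Rightarrow>\<^sub>0 int) set"
  where "tensor_kernel R M N =
    generate (free_Abelian_group (carrier M \<times> carrier N)) (tensor_relations R M N)"

definition tensor_group ::
  "('r, 'a) ring_scheme \<Rightarrow> ('r, 'm, 'b) module_scheme \<Rightarrow> ('r, 'n, 'c) module_scheme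
     \<Rightarrow> (('m \<times> 'n) \<Rightarrow>\<^sub>0 int) set monoid"
  where "tensor_group R M N =
    free_Abelian_group (carrier M \<times> carrier N) Mod tensor_kernel R M N"

text \<open>The homomorphism from \<open>M \<otimes> N\<close> to \<open>M \<otimes> N'\<close> induced by a linear map \<open>f\<close> from \<open>N\<close> to \<open>N'\<close>:
  it sends the coset of \<open>c\<close> to the coset of the image of \<open>c\<close> under \<open>(x, y) \<mapsto> (x, f y)\<close>.\<close>

definition tensor_map ::
  "('r, 'a) ring_scheme \<Rightarrow> ('r, 'm, 'b) module_scheme \<Rightarrow> ('r, 'n, 'c) module_scheme
     \<Rightarrow> ('n \<Rightarrow> 'n) \<Rightarrow> (('m \<times> 'n) \<Rightarrow>\<^sub>0 int) set \<Rightarrow> (('m \<times> 'n) \<Rightarrow>\<^sub>0 int) set"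
  where "tensor_map R M N' f C =
    the_elem ((\<lambda>c. tensor_kernel R M N' #>\<^bsub>free_Abelian_group (carrier M \<times> carrier N')\<^esub>
                     frag_extend (\<lambda>(x, y). frag_of (x, f y)) c) ` C)"

definition module_homs ::
  "('r, 'a) ring_scheme \<Rightarrow> ('r, 'm, 'b) module_scheme \<Rightarrow> ('r, 'n, 'c) module_scheme
     \<Rightarrow> ('m \<Rightarrow> 'n) set"
  where "module_homs R M N =
    {f \<in> carrier M \<rightarrow> carrier N.
       (\<forall>x\<in>carrier M. \<forall>y\<in>carrier M. f (x \<oplus>\<^bsub>M\<^esub> y) = f x \<oplus>\<^bsub>N\<^esub> f y) \<and>
       (\<forall>r\<in>carrier R. \<forall>x\<in>carrier M. f (r \<odot>\<^bsub>M\<^esub> x) = r \<odot>\<^bsub>N\<^esub> f x)}"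

text \<open>Exactness of \<open>N\<^sub>1 \<rightarrow> N\<^sub>2 \<rightarrow> N\<^sub>3\<close>, and of that sequence tensored with \<open>M\<close>.\<close>

definition exact_modules ::
  "('r, 'n, 'c) module_scheme \<Rightarrow> ('r, 'n, 'c) module_scheme \<Rightarrow> ('r, 'n, 'c) module_scheme
     \<Rightarrow> ('n \<Rightarrow> 'n) \<Rightarrow> ('n \<Rightarrow> 'n) \<Rightarrow> bool"
  where "exact_modules N1 N2 N3 u v \<longleftrightarrow>
    kernel (add_monoid N2) (add_monoid N3) v = u ` carrier N1"

definition exact_tensored ::
  "('r, 'a) ring_scheme \<Rightarrow> ('r, 'm, 'b) module_scheme
     \<Rightarrow> ('r, 'n, 'c) module_scheme \<Rightarrow> ('r, 'n, 'c) module_scheme \<Rightarrow> ('r, 'n, 'c) module_scheme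
     \<Rightarrow> ('n \<Rightarrow> 'n) \<Rightarrow> ('n \<Rightarrow> 'n) \<Rightarrow> bool"
  where "exact_tensored R M N1 N2 N3 u v \<longleftrightarrow>
    kernel (tensor_group R M N2) (tensor_group R M N3) (tensor_map R M N3 v)
      = tensor_map R M N2 u ` carrier (tensor_group R M N1)"

text \<open>
  A module is flat if tensoring with it preserves exactness, and faithfully flat if tensoring with
  it preserves and reflects exactness, of all three-term sequences of modules. HOL cannot quantify
  over types, so the type \<open>'n\<close> of the elements of the test modules is a parameter, playing the role
  of a universe. A result about these notions is meant to be stated for an arbitrary type \<open>'n\<close>,
  which then covers test modules of every size.
\<close>

definition flat_module ::
  "'n itself \<Rightarrow> ('r, 'a) ring_scheme \<Rightarrow> ('r, 'm, 'b) module_scheme \<Rightarrow> bool"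
  where "flat_module _ R M \<longleftrightarrow>
    (\<forall>(N1 :: ('r, 'n) module) (N2 :: ('r, 'n) module) (N3 :: ('r, 'n) module) u v.
       Module.module R N1 \<and> Module.module R N2 \<and> Module.module R N3 \<and>
       u \<in> module_homs R N1 N2 \<and> v \<in> module_homs R N2 N3 \<longrightarrow>
       exact_modules N1 N2 N3 u v \<longrightarrow> exact_tensored R M N1 N2 N3 u v)"

definition faithfully_flat_module ::
  "'n itself \<Rightarrow> ('r, 'a) ring_scheme \<Rightarrow> ('r, 'm, 'b) module_scheme \<Rightarrow> bool"
  where "faithfully_flat_module _ R M \<longleftrightarrow>
    (\<forall>(N1 :: ('r, 'n) module) (N2 :: ('r, 'n) module) (N3 :: ('r, 'n) module) u v.
       Module.module R N1 \<and> Module.module R N2 \<and> Module.module R N3 \<and>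
       u \<in> module_homs R N1 N2 \<and> v \<in> module_homs R N2 N3 \<longrightarrow>
       (exact_modules N1 N2 N3 u v \<longleftrightarrow> exact_tensored R M N1 N2 N3 u v))"


section \<open>Integer-valued rational functions\<close>

text \<open>The domain \<open>D\<close> is the type \<open>'d\<close>, its quotient field \<open>K\<close> is \<open>'d fract\<close>,
  and \<open>K(X)\<close> is the fraction field of \<open>K[X]\<close>.\<close>

definition ratfun_defined_at :: "'k::field poly fract \<Rightarrow> 'k \<Rightarrow> bool"
  where "ratfun_defined_at f e \<longleftrightarrow> (\<exists>p q. f = Fract p q \<and> poly q e \<noteq> 0)"

definition ratfun_eval :: "'k::field poly fract \<Rightarrow> 'k \<Rightarrow> 'k"
  where "ratfun_eval f e =
    (THE v. \<exists>p q. f = Fract p q \<and> poly q e \<noteq> 0 \<and> v = poly p e / poly q e)"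

definition Int_R :: "'d::idom fract set \<Rightarrow> 'd fract poly fract set"
  where "Int_R E = {f. \<forall>e\<in>E. ratfun_defined_at f e \<and> ratfun_eval f e \<in> range to_fract}"

definition Int_R_module :: "'d::idom fract set \<Rightarrow> ('d, 'd fract poly fract) module"
  where "Int_R_module E =
    \<lparr>carrier = Int_R E, monoid.mult = (*), one = 1, zero = 0, add = (+),
     module.smult = (\<lambda>d f. to_fract [:to_fract d:] * f)\<rparr>"


section \<open>Integer-valued polynomials with coefficients in an extension\<close>

text \<open>The inclusion of \<open>D\<close> into the domain \<open>B\<close> is an injective ring homomorphism \<open>\<phi>\<close>;
  it induces the inclusion of \<open>K\<close> into the quotient field of \<open>B\<close>.\<close>

definition fract_map :: "('d::idom \<Rightarrow> 'b::idom) \<Rightarrow> 'd fract \<Rightarrow> 'b fract"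
  where "fract_map \<phi> x = (THE y. \<exists>a b. b \<noteq> 0 \<and> x = Fract a b \<and> y = Fract (\<phi> a) (\<phi> b))"

definition Int_ext :: "('d::idom \<Rightarrow> 'b::idom) \<Rightarrow> 'd fract set \<Rightarrow> 'b poly set"
  where "Int_ext \<phi> E =
    {f. \<forall>e\<in>E. poly (map_poly to_fract f) (fract_map \<phi> e) \<in> range (\<lambda>d. to_fract (\<phi> d))}"

definition Int_ext_module :: "('d::idom \<Rightarrow> 'b::idom) \<Rightarrow> 'd fract set \<Rightarrow> ('d, 'b poly) module"
  where "Int_ext_module \<phi> E =
    \<lparr>carrier = Int_ext \<phi> E, monoid.mult = (*), one = 1, zero = 0, add = (+),
     module.smult = (\<lambda>d f. Polynomial.smult (\<phi> d) f)\<rparr>"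

end

theory Submission
  imports Defs
begin

text \<open>
  Fix \<open>e \<in> E\<close> and let \<open>M\<close> be one of the two modules. Evaluation at \<open>e\<close> is a \<open>D\<close>-linear functional
  \<open>\<epsilon>\<close> from \<open>M\<close> to \<open>D\<close>, and it takes the value 1 on the constant 1. The constants therefore form a
  direct summand of \<open>M\<close> isomorphic to \<open>D\<close>.

  Such a module reflects exactness, whether it is flat or not. For every module \<open>N\<close> the maps
  \<open>y \<mapsto> 1 \<otimes> y\<close> from \<open>N\<close> to \<open>M \<otimes> N\<close> and \<open>x \<otimes> y \<mapsto> \<epsilon>(x) y\<close> back to \<open>N\<close> are natural in \<open>N\<close> and
  compose to the identity of \<open>N\<close>. Hence every sequence of modules is a retract of its tensor product
  with \<open>M\<close>, and a retract of an exact sequence is exact (\<open>exact_tensored_imp_exact\<close>). Preservation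
  of exactness is flatness, so \<open>M\<close> is flat if and only if it is faithfully flat. The argument uses
  only the modules of the given sequence as test modules, and so it works over every type of
  their elements.
\<close>

section \<open>The maps induced on tensor products\<close>

lemma diff_in_free_Abelian_group:
  assumes "a \<in> carrier (free_Abelian_group S)" "b \<in> carrier (free_Abelian_group S)"
  shows "a - b \<in> carrier (free_Abelian_group S)"
  using assms keys_diff[of a b] by auto

lemma hom_free_Abelian_group_diff:
  assumes "group H" and h: "h \<in> hom (free_Abelian_group S) H"
    and a: "a \<in> carrier (free_Abelian_group S)" and b: "b \<in> carrier (free_Abelian_group S)"
  shows "h (a - b) = h a \<otimes>\<^bsub>H\<^esub> inv\<^bsub>H\<^esub> h b"
proof -
  interpret h: group_hom "free_Abelian_group S" H h
    by (intro group_hom.intro group_hom_axioms.intro assms(1) h group_free_Abelian_group)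
  have "a - b = a \<otimes>\<^bsub>free_Abelian_group S\<^esub> inv\<^bsub>free_Abelian_group S\<^esub> b"
    using b by simp
  then show ?thesis
    using a b by (simp only: h.hom_mult h.hom_inv h.G.inv_closed)
qed

lemma hom_free_Abelian_group_eqI:
  assumes H: "group H" and h: "h \<in> hom (free_Abelian_group S) H"
    and k: "k \<in> hom (free_Abelian_group S) H"
    and eq: "\<And>a. a \<in> S \<Longrightarrow> h (frag_of a) = k (frag_of a)"
    and c: "c \<in> carrier (free_Abelian_group S)"
  shows "h c = k c"
proof -
  have "Poly_Mapping.keys c \<subseteq> S" using c by simp
  then show ?thesis
  proof (induction c rule: free_Abelian_group_induct[consumes 1])
    case 1
    show ?case using hom_one[OF h] hom_one[OF k] H by simp
  next
    case (2 x y)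
    then show ?case
      by (simp add: hom_free_Abelian_group_diff[OF H h] hom_free_Abelian_group_diff[OF H k])
  next
    case (3 a)
    then show ?case by (rule eq)
  qed
qed

lemma tensor_relations_carrier:
  assumes "Module.module R M" and "Module.module R N"
  shows "tensor_relations R M N \<subseteq> carrier (free_Abelian_group (carrier M \<times> carrier N))"
proof -
  interpret M: Module.module R M by fact
  interpret N: Module.module R N by fact
  show ?thesis
    unfolding tensor_relations_def
    by (auto simp del: carrier_free_Abelian_group_iff intro!: diff_in_free_Abelian_group)
qed

lemma tensor_kernel_subgroup:
  assumes "Module.module R M" and "Module.module R N"
  shows "subgroup (tensor_kernel R M N) (free_Abelian_group (carrier M \<times> carrier N))"
  unfolding tensor_kernel_def
  by (intro group.generate_is_subgroup group_free_Abelian_group tensor_relations_carrier assms)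

lemma frag_extend_in_tensor_carrier:
  assumes "f \<in> module_homs R N N'" and "c \<in> carrier (free_Abelian_group (carrier M \<times> carrier N))"
  shows "frag_extend (\<lambda>(x, y). frag_of (x, f y)) c
           \<in> carrier (free_Abelian_group (carrier M \<times> carrier N'))"
proof -
  have "f y \<in> carrier N'" if "y \<in> carrier N" for y
    using assms(1) that by (auto simp: module_homs_def)
  then have "(\<Union>p\<in>Poly_Mapping.keys c. Poly_Mapping.keys ((\<lambda>(x, y). frag_of (x, f y)) p))
      \<subseteq> carrier M \<times> carrier N'"
    using assms(2) by (auto simp: subset_iff)
  then show ?thesis
    using subset_trans[OF keys_frag_extend] by simp
qed

lemma frag_extend_tensor_hom:
  assumes "f \<in> module_homs R N N'"
  shows "frag_extend (\<lambda>(x, y). frag_of (x, f y))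
    \<in> hom (free_Abelian_group (carrier M \<times> carrier N)) (free_Abelian_group (carrier M \<times> carrier N'))"
  by (rule homI) (use frag_extend_in_tensor_carrier[OF assms] in \<open>simp_all only: mult_free_Abelian_group frag_extend_add\<close>)

lemma frag_extend_tensor_relations:
  assumes "f \<in> module_homs R N N'" and "c \<in> tensor_relations R M N"
  shows "frag_extend (\<lambda>(x, y). frag_of (x, f y)) c \<in> tensor_relations R M N'"
proof -
  have f: "\<And>y. y \<in> carrier N \<Longrightarrow> f y \<in> carrier N'"
    "\<And>y z. y \<in> carrier N \<Longrightarrow> z \<in> carrier N \<Longrightarrow> f (y \<oplus>\<^bsub>N\<^esub> z) = f y \<oplus>\<^bsub>N'\<^esub> f z"
    "\<And>r y. r \<in> carrier R \<Longrightarrow> y \<in> carrier N \<Longrightarrow> f (r \<odot>\<^bsub>N\<^esub> y) = r \<odot>\<^bsub>N'\<^esub> f y"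
    using assms(1) by (auto simp: module_homs_def)
  show ?thesis
    using assms(2) unfolding tensor_relations_def
  proof (elim UnE, goal_cases)
    case 1
    show ?case by (rule UnI1, rule UnI1) (use 1 in \<open>force simp: frag_extend_diff f\<close>)
  next
    case 2
    show ?case by (rule UnI1, rule UnI2) (use 2 in \<open>force simp: frag_extend_diff f\<close>)
  next
    case 3
    show ?case by (rule UnI2) (use 3 in \<open>force simp: frag_extend_diff f\<close>)
  qed
qed

lemma frag_extend_tensor_kernel:
  assumes M: "Module.module R M" and N: "Module.module R N" and N': "Module.module R N'"
    and f: "f \<in> module_homs R N N'" and c: "c \<in> tensor_kernel R M N"
  shows "frag_extend (\<lambda>(x, y). frag_of (x, f y)) c \<in> tensor_kernel R M N'"
proof -
  let ?F = "free_Abelian_group (carrier M \<times> carrier N)"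
  let ?F' = "free_Abelian_group (carrier M \<times> carrier N')"
  let ?e = "frag_extend (\<lambda>(x, y). frag_of (x, f y))"
  interpret e: group_hom ?F ?F' ?e
    by (intro group_hom.intro group_hom_axioms.intro group_free_Abelian_group
        frag_extend_tensor_hom[OF f])
  have "?e ` tensor_kernel R M N = generate ?F' (?e ` tensor_relations R M N)"
    unfolding tensor_kernel_def by (rule e.generate_img[OF tensor_relations_carrier[OF M N], symmetric])
  also have "\<dots> \<subseteq> tensor_kernel R M N'"
    unfolding tensor_kernel_def
    by (rule group.mono_generate) (use frag_extend_tensor_relations[OF f] in auto)
  finally show ?thesis using c by blast
qed

text \<open>On cosets the induced map is computed on any representative, because the bilinearity relations
  are preserved.\<close>

lemma tensor_map_coset:
  assumes M: "Module.module R M" and N: "Module.module R N" and N': "Module.module R N'"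
    and f: "f \<in> module_homs R N N'"
    and c: "c \<in> carrier (free_Abelian_group (carrier M \<times> carrier N))"
  shows "tensor_map R M N' f
           (tensor_kernel R M N #>\<^bsub>free_Abelian_group (carrier M \<times> carrier N)\<^esub> c) =
         tensor_kernel R M N' #>\<^bsub>free_Abelian_group (carrier M \<times> carrier N')\<^esub>
           frag_extend (\<lambda>(x, y). frag_of (x, f y)) c"
proof -
  let ?F = "free_Abelian_group (carrier M \<times> carrier N)"
  let ?F' = "free_Abelian_group (carrier M \<times> carrier N')"
  let ?e = "frag_extend (\<lambda>(x, y). frag_of (x, f y))"
  let ?K' = "tensor_kernel R M N'"
  let ?C = "tensor_kernel R M N #>\<^bsub>?F\<^esub> c"
  have same: "?K' #>\<^bsub>?F'\<^esub> ?e d = ?K' #>\<^bsub>?F'\<^esub> ?e c" if "d \<in> ?C" for d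
  proof -
    from that obtain k where k: "k \<in> tensor_kernel R M N" "d = k + c"
      by (auto simp: r_coset_def)
    have "?e d \<in> ?K' #>\<^bsub>?F'\<^esub> ?e c"
      using frag_extend_tensor_kernel[OF M N N' f k(1)]
      by (auto simp: k(2) frag_extend_add r_coset_def)
    then show ?thesis
      using frag_extend_in_tensor_carrier[OF f c] tensor_kernel_subgroup[OF M N']
      by (metis group.repr_independence group_free_Abelian_group)
  qed
  moreover have "c \<in> ?C"
    by (rule group.rcos_self[OF group_free_Abelian_group c tensor_kernel_subgroup[OF M N]])
  ultimately have "(\<lambda>d. ?K' #>\<^bsub>?F'\<^esub> ?e d) ` ?C = {?K' #>\<^bsub>?F'\<^esub> ?e c}" by blast
  then show ?thesis by (simp add: tensor_map_def)
qed


section \<open>Modules with a unimodular element\<close>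

text \<open>A module with an element \<open>m\<close> on which some linear functional \<open>\<epsilon>\<close> takes the value 1,
  that is, a module with a split embedding of the base ring.\<close>

locale unimodular_module = module R M for R (structure) and M (structure) +
  fixes \<epsilon> :: "'c \<Rightarrow> 'a" and m :: 'c
  assumes functional_closed: "x \<in> carrier M \<Longrightarrow> \<epsilon> x \<in> carrier R"
    and functional_add: "x \<in> carrier M \<Longrightarrow> y \<in> carrier M \<Longrightarrow> \<epsilon> (x \<oplus>\<^bsub>M\<^esub> y) = \<epsilon> x \<oplus> \<epsilon> y"
    and functional_smult: "r \<in> carrier R \<Longrightarrow> x \<in> carrier M \<Longrightarrow> \<epsilon> (r \<odot>\<^bsub>M\<^esub> x) = r \<otimes> \<epsilon> x"
    and element_closed: "m \<in> carrier M"
    and functional_element: "\<epsilon> m = \<one>"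
begin

text \<open>The map \<open>x \<otimes> y \<mapsto> \<epsilon>(x) y\<close> from \<open>M \<otimes> N\<close> to \<open>N\<close>, as a homomorphism on the free abelian group
  that vanishes on the bilinearity relations.\<close>

lemma contraction_exists:
  assumes N: "Module.module R N"
  obtains h where "h \<in> hom (free_Abelian_group (carrier M \<times> carrier N)) (add_monoid N)"
    and "\<And>x y. x \<in> carrier M \<Longrightarrow> y \<in> carrier N \<Longrightarrow> h (frag_of (x, y)) = \<epsilon> x \<odot>\<^bsub>N\<^esub> y"
    and "\<And>c. c \<in> tensor_kernel R M N \<Longrightarrow> h c = \<zero>\<^bsub>N\<^esub>"
proof -
  interpret N: Module.module R N by fact
  let ?F = "free_Abelian_group (carrier M \<times> carrier N)"
  have "(\<lambda>(x, y). \<epsilon> x \<odot>\<^bsub>N\<^esub> y) ` (carrier M \<times> carrier N) \<subseteq> carrier (add_monoid N)"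
    using functional_closed by auto
  then obtain h where h: "h \<in> hom ?F (add_monoid N)"
    and h_pair: "\<And>p. p \<in> carrier M \<times> carrier N \<Longrightarrow> h (frag_of p) = (\<lambda>(x, y). \<epsilon> x \<odot>\<^bsub>N\<^esub> y) p"
    using comm_group.free_Abelian_group_universal[OF N.a_comm_group] by metis
  have h_of: "h (frag_of (x, y)) = \<epsilon> x \<odot>\<^bsub>N\<^esub> y"
    if "x \<in> carrier M" "y \<in> carrier N" for x y
    using h_pair[of "(x, y)"] that by simp
  interpret h: group_hom ?F "add_monoid N" h
    by (intro group_hom.intro group_hom_axioms.intro h group_free_Abelian_group N.a_group)
  have h_diff: "h (a - b) = h a \<oplus>\<^bsub>N\<^esub> \<ominus>\<^bsub>N\<^esub> h b" if "a \<in> carrier ?F" "b \<in> carrier ?F" for a b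
    using hom_free_Abelian_group_diff[OF N.a_group h that] by (simp add: a_inv_def)
  have cancel: "a \<oplus>\<^bsub>N\<^esub> b \<oplus>\<^bsub>N\<^esub> \<ominus>\<^bsub>N\<^esub> a \<oplus>\<^bsub>N\<^esub> \<ominus>\<^bsub>N\<^esub> b = \<zero>\<^bsub>N\<^esub>"
    if "a \<in> carrier N" "b \<in> carrier N" for a b
    using that by (simp add: N.a_comm[of a b] N.a_assoc N.r_neg)
  have "tensor_relations R M N \<subseteq> kernel ?F (add_monoid N) h"
  proof
    fix c assume c: "c \<in> tensor_relations R M N"
    then have "h c = \<zero>\<^bsub>N\<^esub>"
      unfolding tensor_relations_def
      by (auto simp del: carrier_free_Abelian_group_iff
          simp: h_diff diff_in_free_Abelian_group h_of functional_closed functional_add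
            functional_smult N.smult_l_distr N.smult_r_distr N.smult_assoc1[symmetric] R.m_comm
            N.r_neg cancel)
    then show "c \<in> kernel ?F (add_monoid N) h"
      using subsetD[OF tensor_relations_carrier[OF module_axioms N] c] by (simp add: kernel_def)
  qed
  then have "tensor_kernel R M N \<subseteq> kernel ?F (add_monoid N) h"
    unfolding tensor_kernel_def
    by (rule h.G.generate_subgroup_incl[OF _ h.subgroup_kernel])
  then have "h c = \<zero>\<^bsub>N\<^esub>" if "c \<in> tensor_kernel R M N" for c
    using that by (auto simp: kernel_def)
  with h h_of show ?thesis by (rule that)
qed

lemma exact_tensored_imp_exact:
  assumes N1: "Module.module R N1" and N2: "Module.module R N2" and N3: "Module.module R N3"
    and u: "u \<in> module_homs R N1 N2" and v: "v \<in> module_homs R N2 N3"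
    and ex: "exact_tensored R M N1 N2 N3 u v"
  shows "exact_modules N1 N2 N3 u v"
proof -
  interpret N1: Module.module R N1 by fact
  interpret N2: Module.module R N2 by fact
  interpret N3: Module.module R N3 by fact
  let ?F1 = "free_Abelian_group (carrier M \<times> carrier N1)"
  let ?F2 = "free_Abelian_group (carrier M \<times> carrier N2)"
  let ?F3 = "free_Abelian_group (carrier M \<times> carrier N3)"
  let ?K1 = "tensor_kernel R M N1" and ?K2 = "tensor_kernel R M N2" and ?K3 = "tensor_kernel R M N3"
  let ?Tu = "tensor_map R M N2 u" and ?Tv = "tensor_map R M N3 v"
  let ?eu = "frag_extend (\<lambda>(x, y). frag_of (x, u y))"
  note M = module_axioms
  note coset_u = tensor_map_coset[OF M N1 N2 u] and coset_v = tensor_map_coset[OF M N2 N3 v]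
  have u_closed: "\<And>y. y \<in> carrier N1 \<Longrightarrow> u y \<in> carrier N2"
    and u_add: "\<And>y z. y \<in> carrier N1 \<Longrightarrow> z \<in> carrier N1 \<Longrightarrow> u (y \<oplus>\<^bsub>N1\<^esub> z) = u y \<oplus>\<^bsub>N2\<^esub> u z"
    and u_smult: "\<And>r y. r \<in> carrier R \<Longrightarrow> y \<in> carrier N1 \<Longrightarrow> u (r \<odot>\<^bsub>N1\<^esub> y) = r \<odot>\<^bsub>N2\<^esub> u y"
    and v_closed: "\<And>y. y \<in> carrier N2 \<Longrightarrow> v y \<in> carrier N3"
    using u v by (auto simp: module_homs_def)
  have u_hom: "u \<in> hom (add_monoid N1) (add_monoid N2)"
    by (rule homI) (auto simp: u_closed u_add)
  obtain h1 where h1: "h1 \<in> hom ?F1 (add_monoid N1)"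
    and h1_of: "\<And>x y. x \<in> carrier M \<Longrightarrow> y \<in> carrier N1 \<Longrightarrow> h1 (frag_of (x, y)) = \<epsilon> x \<odot>\<^bsub>N1\<^esub> y"
    using contraction_exists[OF N1] by metis
  obtain h2 where h2: "h2 \<in> hom ?F2 (add_monoid N2)"
    and h2_of: "\<And>x y. x \<in> carrier M \<Longrightarrow> y \<in> carrier N2 \<Longrightarrow> h2 (frag_of (x, y)) = \<epsilon> x \<odot>\<^bsub>N2\<^esub> y"
    and h2_kernel: "\<And>c. c \<in> ?K2 \<Longrightarrow> h2 c = \<zero>\<^bsub>N2\<^esub>"
    using contraction_exists[OF N2] by metis
  obtain h3 where h3_of: "\<And>x y. x \<in> carrier M \<Longrightarrow> y \<in> carrier N3 \<Longrightarrow> h3 (frag_of (x, y)) = \<epsilon> x \<odot>\<^bsub>N3\<^esub> y"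
    and h3_kernel: "\<And>c. c \<in> ?K3 \<Longrightarrow> h3 c = \<zero>\<^bsub>N3\<^esub>"
    using contraction_exists[OF N3] by metis
  have one1: "frag_of (m, y) \<in> carrier ?F1" if "y \<in> carrier N1" for y
    using that element_closed by simp
  have one2: "frag_of (m, y) \<in> carrier ?F2" if "y \<in> carrier N2" for y
    using that element_closed by simp
  have one3: "frag_of (m, y) \<in> carrier ?F3" if "y \<in> carrier N3" for y
    using that element_closed by simp

  \<comment> \<open>The contraction \<open>x \<otimes> y \<mapsto> \<epsilon>(x) y\<close> is natural with respect to \<open>u\<close>.\<close>
  have natural: "h2 (?eu c) = u (h1 c)" if c: "c \<in> carrier ?F1" for c
  proof -
    note eu_hom = frag_extend_tensor_hom[OF u]
    have "(h2 \<circ> ?eu) c = (u \<circ> h1) c"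
    proof (rule hom_free_Abelian_group_eqI[OF N2.a_group Group.hom_compose[OF eu_hom h2]
          Group.hom_compose[OF h1 u_hom] _ c])
      fix p assume "p \<in> carrier M \<times> carrier N1"
      then show "(h2 \<circ> ?eu) (frag_of p) = (u \<circ> h1) (frag_of p)"
        by (auto simp: h1_of h2_of u_closed u_smult functional_closed)
    qed
    then show ?thesis by simp
  qed

  \<comment> \<open>The injection \<open>y \<mapsto> m \<otimes> y\<close> is natural with respect to \<open>v\<close>, so that \<open>m \<otimes> y\<close> is killed
    if and only if \<open>v y = 0\<close>.\<close>
  have in_kernel: "?K2 #>\<^bsub>?F2\<^esub> frag_of (m, y) \<in> kernel (tensor_group R M N2) (tensor_group R M N3) ?Tv
      \<longleftrightarrow> v y = \<zero>\<^bsub>N3\<^esub>" if y: "y \<in> carrier N2" for y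
  proof -
    have vy: "v y \<in> carrier N3" using y v_closed by blast
    have "?K2 #>\<^bsub>?F2\<^esub> frag_of (m, y) \<in> kernel (tensor_group R M N2) (tensor_group R M N3) ?Tv
        \<longleftrightarrow> ?K3 #>\<^bsub>?F3\<^esub> frag_of (m, v y) = ?K3"
      using one2[OF y] coset_v[OF one2[OF y]]
      by (auto simp: kernel_def tensor_group_def FactGroup_def RCOSETS_def
          simp del: carrier_free_Abelian_group_iff)
    also have "\<dots> \<longleftrightarrow> frag_of (m, v y) \<in> ?K3"
      using group.coset_join1[OF group_free_Abelian_group _ one3[OF vy] tensor_kernel_subgroup[OF M N3]]
        group.coset_join2[OF group_free_Abelian_group one3[OF vy] tensor_kernel_subgroup[OF M N3]]
      by blast
    also have "\<dots> \<longleftrightarrow> v y = \<zero>\<^bsub>N3\<^esub>"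
    proof
      assume "frag_of (m, v y) \<in> ?K3"
      then show "v y = \<zero>\<^bsub>N3\<^esub>"
        using h3_kernel h3_of[OF element_closed vy] functional_element vy by simp
    next
      assume v0: "v y = \<zero>\<^bsub>N3\<^esub>"
      \<comment> \<open>The relation \<open>m \<otimes> (0 + 0) = m \<otimes> 0 + m \<otimes> 0\<close> gives \<open>m \<otimes> 0 = 0\<close>.\<close>
      have "frag_of (m, \<zero>\<^bsub>N3\<^esub> \<oplus>\<^bsub>N3\<^esub> \<zero>\<^bsub>N3\<^esub>) - frag_of (m, \<zero>\<^bsub>N3\<^esub>) - frag_of (m, \<zero>\<^bsub>N3\<^esub>)
          \<in> tensor_relations R M N3"
        unfolding tensor_relations_def using element_closed N3.zero_closed by blast
      then have "- frag_of (m, \<zero>\<^bsub>N3\<^esub>) \<in> ?K3"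
        unfolding tensor_kernel_def by (simp add: generate.incl)
      then have "inv\<^bsub>?F3\<^esub> (- frag_of (m, \<zero>\<^bsub>N3\<^esub>)) \<in> ?K3"
        using subgroup.m_inv_closed[OF tensor_kernel_subgroup[OF M N3]] by blast
      then show "frag_of (m, v y) \<in> ?K3"
        using element_closed by (simp add: v0)
    qed
    finally show ?thesis .
  qed

  have "kernel (add_monoid N2) (add_monoid N3) v = u ` carrier N1"
  proof (intro equalityI subsetI)
    fix y assume "y \<in> kernel (add_monoid N2) (add_monoid N3) v"
    then have y: "y \<in> carrier N2" "v y = \<zero>\<^bsub>N3\<^esub>" by (auto simp: kernel_def)
    then have "?K2 #>\<^bsub>?F2\<^esub> frag_of (m, y) \<in> ?Tu ` carrier (tensor_group R M N1)"
      using in_kernel ex unfolding exact_tensored_def by blast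
    then obtain c where c: "c \<in> carrier ?F1"
      and "?K2 #>\<^bsub>?F2\<^esub> frag_of (m, y) = ?Tu (?K1 #>\<^bsub>?F1\<^esub> c)"
      by (auto simp: tensor_group_def FactGroup_def RCOSETS_def
          simp del: carrier_free_Abelian_group_iff)
    then have "?K2 #>\<^bsub>?F2\<^esub> frag_of (m, y) = ?K2 #>\<^bsub>?F2\<^esub> ?eu c"
      using coset_u by simp
    then have "frag_of (m, y) \<in> ?K2 #>\<^bsub>?F2\<^esub> ?eu c"
      using group.rcos_self[OF group_free_Abelian_group one2[OF y(1)] tensor_kernel_subgroup[OF M N2]]
      by simp
    then obtain k where k: "k \<in> ?K2" "frag_of (m, y) = k \<otimes>\<^bsub>?F2\<^esub> ?eu c"
      by (auto simp: r_coset_def)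
    \<comment> \<open>Contracting \<open>m \<otimes> y\<close>, the image of \<open>c\<close>, gives \<open>y = u (h1 c)\<close>.\<close>
    have "y = h2 (frag_of (m, y))"
      using h2_of[OF element_closed y(1)] functional_element y(1) by simp
    also have "\<dots> = h2 k \<oplus>\<^bsub>N2\<^esub> h2 (?eu c)"
      unfolding k(2)
      using hom_mult[OF h2 subgroup.mem_carrier[OF tensor_kernel_subgroup[OF M N2] k(1)]
          frag_extend_in_tensor_carrier[OF u c]] by simp
    also have "\<dots> = u (h1 c)"
      using h2_kernel[OF k(1)] natural[OF c] u_closed hom_in_carrier[OF h1 c] by simp
    finally show "y \<in> u ` carrier N1"
      using hom_in_carrier[OF h1 c] by simp
  next
    fix y assume "y \<in> u ` carrier N1"
    then obtain z where z: "z \<in> carrier N1" "y = u z" by blast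
    have "?Tu (?K1 #>\<^bsub>?F1\<^esub> frag_of (m, z)) = ?K2 #>\<^bsub>?F2\<^esub> frag_of (m, y)"
      using coset_u[OF one1[OF z(1)]] z(2) by simp
    moreover have "?K1 #>\<^bsub>?F1\<^esub> frag_of (m, z) \<in> carrier (tensor_group R M N1)"
      using one1[OF z(1)]
      by (auto simp: tensor_group_def FactGroup_def RCOSETS_def
          simp del: carrier_free_Abelian_group_iff)
    ultimately have "?K2 #>\<^bsub>?F2\<^esub> frag_of (m, y) \<in> ?Tu ` carrier (tensor_group R M N1)"
      by (metis imageI)
    then have "?K2 #>\<^bsub>?F2\<^esub> frag_of (m, y)
        \<in> kernel (tensor_group R M N2) (tensor_group R M N3) ?Tv"
      using ex unfolding exact_tensored_def by simp
    then have "v y = \<zero>\<^bsub>N3\<^esub>" using in_kernel u_closed z by blast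
    then show "y \<in> kernel (add_monoid N2) (add_monoid N3) v"
      using u_closed z by (simp add: kernel_def)
  qed
  then show ?thesis by (simp add: exact_modules_def)
qed

lemma flat_iff_faithfully_flat:
  "flat_module TYPE('n) R M \<longleftrightarrow> faithfully_flat_module TYPE('n) R M"
  unfolding flat_module_def faithfully_flat_module_def
  using exact_tensored_imp_exact by metis

end


section \<open>Evaluation at a point\<close>

text \<open>The value does not depend on the fraction chosen to represent the rational function, as long
  as its denominator does not vanish at the point.\<close>

lemma ratfun_eval_Fract:
  fixes p q :: "'k::field poly"
  assumes "poly q e \<noteq> 0"
  shows "ratfun_defined_at (Fract p q) e" and "ratfun_eval (Fract p q) e = poly p e / poly q e"
proof -
  show "ratfun_defined_at (Fract p q) e"
    using assms unfolding ratfun_defined_at_def by blast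
  show "ratfun_eval (Fract p q) e = poly p e / poly q e"
    unfolding ratfun_eval_def
  proof (rule the_equality)
    fix w assume "\<exists>p' q'. Fract p q = Fract p' q' \<and> poly q' e \<noteq> 0 \<and> w = poly p' e / poly q' e"
    then obtain p' q' where eq: "Fract p q = Fract p' q'" and q': "poly q' e \<noteq> 0"
      and w: "w = poly p' e / poly q' e" by blast
    have "p * q' = p' * q" using eq q' assms by (subst (asm) eq_fract) auto
    then have "poly p e * poly q' e = poly p' e * poly q e" by (metis poly_mult)
    then show "w = poly p e / poly q e" using assms q' w
      by (metis frac_eq_eq)
  qed (use assms in blast)
qed

lemma ratfun_eval_add:
  assumes "ratfun_defined_at f e" and "ratfun_defined_at g e"
  shows "ratfun_defined_at (f + g) e" and "ratfun_eval (f + g) e = ratfun_eval f e + ratfun_eval g e"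
proof -
  obtain p q p' q' where fg: "f = Fract p q" "poly q e \<noteq> 0" "g = Fract p' q'" "poly q' e \<noteq> 0"
    using assms unfolding ratfun_defined_at_def by blast
  then have sum: "f + g = Fract (p * q' + p' * q) (q * q')" by (subst fg, subst fg, subst add_fract) auto
  have "poly (q * q') e \<noteq> 0" using fg by simp
  then show "ratfun_defined_at (f + g) e"
    unfolding sum by (rule ratfun_eval_Fract)
  show "ratfun_eval (f + g) e = ratfun_eval f e + ratfun_eval g e"
    unfolding sum ratfun_eval_Fract(2)[OF \<open>poly (q * q') e \<noteq> 0\<close>]
    using fg by (simp add: ratfun_eval_Fract field_simps)
qed

lemma ratfun_eval_const_mult:
  assumes "ratfun_defined_at f e"
  shows "ratfun_defined_at (to_fract [:c:] * f) e"
    and "ratfun_eval (to_fract [:c:] * f) e = c * ratfun_eval f e"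
proof -
  obtain p q where f: "f = Fract p q" "poly q e \<noteq> 0"
    using assms unfolding ratfun_defined_at_def by blast
  have "to_fract [:c:] * f = Fract ([:c:] * p) q"
    by (simp add: f to_fract_def del: mult_pCons_left)
  then show "ratfun_defined_at (to_fract [:c:] * f) e"
    "ratfun_eval (to_fract [:c:] * f) e = c * ratfun_eval f e"
    using f by (simp_all add: ratfun_eval_Fract)
qed

lemma ratfun_eval_one: "ratfun_defined_at 1 e" "ratfun_eval 1 e = 1"
  using ratfun_eval_Fract[of 1 e 1] by (simp_all add: One_fract_def)

lemma ring_of_type_algebra_simps:
  "carrier ring_of_type_algebra = UNIV" "x \<oplus>\<^bsub>ring_of_type_algebra\<^esub> y = x + y"
  "x \<otimes>\<^bsub>ring_of_type_algebra\<^esub> y = x * y" "\<one>\<^bsub>ring_of_type_algebra\<^esub> = 1"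
  by (simp_all add: ring_of_type_algebra_def)

text \<open>On both modules the functional is evaluation at \<open>e\<close>, read back in \<open>D\<close> through the embedding of
  \<open>D\<close> in the field where the values lie.\<close>

lemma unimodular_Int_R_module:
  fixes E :: "'d::idom fract set"
  assumes e: "e \<in> E"
  shows "unimodular_module ring_of_type_algebra (Int_R_module E) (\<lambda>f. the_inv to_fract (ratfun_eval f e)) 1"
proof -
  have add: "f + g \<in> Int_R E" if "f \<in> Int_R E" "g \<in> Int_R E" for f g
    using that unfolding Int_R_def by (force simp: ratfun_eval_add simp flip: to_fract_add)
  have smult: "to_fract [:to_fract d:] * f \<in> Int_R E" if "f \<in> Int_R E" for d f
    using that unfolding Int_R_def by (force simp: ratfun_eval_const_mult simp flip: to_fract_mult)
  have one: "1 \<in> Int_R E"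
    unfolding Int_R_def using rangeI[of to_fract "1 :: 'd"] by (simp add: ratfun_eval_one)
  have const: "to_fract [:a + b:] = to_fract [:a:] + to_fract [:b:]"
    "to_fract [:a * b:] = to_fract [:a:] * to_fract [:b:]" "to_fract [:1:] = 1" for a b :: "'d fract"
    by (simp_all flip: to_fract_add to_fract_mult one_pCons)
  have neg_eq: "to_fract [:to_fract (- 1):] * f = - f" for f :: "'d fract poly fract"
  proof -
    have "[:- 1:] = - (1 :: 'd fract poly)" by (simp add: one_pCons)
    then show ?thesis by simp
  qed
  have neg: "- f \<in> Int_R E" if "f \<in> Int_R E" for f
    using smult[OF that, of "- 1"] by (simp only: neg_eq)
  have zero: "0 \<in> Int_R E" using add[OF one neg[OF one]] by simp
  have inv: "the_inv to_fract (to_fract d) = d" for d :: 'd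
    by (simp add: the_inv_f_f inj_def)
  have ev: "ratfun_defined_at f e" "\<exists>d. ratfun_eval f e = to_fract d" if "f \<in> Int_R E" for f
    using that e by (auto simp: Int_R_def)
  have "abelian_group (Int_R_module E)"
    by (rule abelian_groupI)
      (auto simp: Int_R_module_def add zero algebra_simps intro!: bexI[of _ "- _"] neg)
  then have "Module.module ring_of_type_algebra (Int_R_module E)"
    by (intro moduleI cring_from_type_algebra)
      (simp_all add: Int_R_module_def ring_of_type_algebra_simps smult const distrib_left
        distrib_right mult.assoc)
  then show ?thesis
  proof (intro unimodular_module.intro unimodular_module_axioms.intro)
    fix f g assume "f \<in> carrier (Int_R_module E)" "g \<in> carrier (Int_R_module E)"
    then have "f \<in> Int_R E" "g \<in> Int_R E" by (simp_all add: Int_R_module_def)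
    from ev[OF this(1)] ev[OF this(2)]
    show "the_inv to_fract (ratfun_eval (f \<oplus>\<^bsub>Int_R_module E\<^esub> g) e) =
        the_inv to_fract (ratfun_eval f e) \<oplus>\<^bsub>ring_of_type_algebra\<^esub> the_inv to_fract (ratfun_eval g e)"
      by (auto simp: Int_R_module_def ring_of_type_algebra_simps ratfun_eval_add inv
          simp flip: to_fract_add)
  next
    fix d f assume "f \<in> carrier (Int_R_module E)"
    then have "f \<in> Int_R E" by (simp add: Int_R_module_def)
    from ev[OF this]
    show "the_inv to_fract (ratfun_eval (d \<odot>\<^bsub>Int_R_module E\<^esub> f) e) =
        d \<otimes>\<^bsub>ring_of_type_algebra\<^esub> the_inv to_fract (ratfun_eval f e)"
      by (auto simp: Int_R_module_def ring_of_type_algebra_simps ratfun_eval_const_mult inv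
          simp flip: to_fract_mult)
  qed (use one inv[of 1] in \<open>simp_all add: Int_R_module_def ring_of_type_algebra_simps ratfun_eval_one\<close>)
qed

lemma unimodular_Int_ext_module:
  fixes \<phi> :: "'d::idom \<Rightarrow> 'b::idom" and E :: "'d fract set"
  assumes hom: "\<phi> \<in> ring_hom ring_of_type_algebra ring_of_type_algebra" and inj: "inj \<phi>"
    and e: "e \<in> E"
  shows "unimodular_module ring_of_type_algebra (Int_ext_module \<phi> E)
    (\<lambda>f. the_inv (\<lambda>d. to_fract (\<phi> d)) (poly (fract_poly f) (fract_map \<phi> e))) 1"
proof -
  have \<phi>_add: "\<phi> (a + b) = \<phi> a + \<phi> b" and \<phi>_mult: "\<phi> (a * b) = \<phi> a * \<phi> b" and \<phi>_one: "\<phi> 1 = 1" for a b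
    using hom by (auto simp: ring_hom_def ring_of_type_algebra_simps)
  have \<phi>_zero: "\<phi> 0 = 0" using \<phi>_add[of 0 0]
    by (metis add_cancel_right_right add.right_neutral)
  have \<phi>_neg: "\<phi> (- 1) = - 1" using \<phi>_add[of "- 1" 1] \<phi>_zero \<phi>_one by (simp add: eq_neg_iff_add_eq_0)
  have add: "f + g \<in> Int_ext \<phi> E" if "f \<in> Int_ext \<phi> E" "g \<in> Int_ext \<phi> E" for f g
    using that unfolding Int_ext_def by (force simp flip: to_fract_add \<phi>_add)
  have smult: "Polynomial.smult (\<phi> d) f \<in> Int_ext \<phi> E" if "f \<in> Int_ext \<phi> E" for d f
    using that unfolding Int_ext_def by (force simp flip: to_fract_mult \<phi>_mult)
  have one: "1 \<in> Int_ext \<phi> E"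
    unfolding Int_ext_def using rangeI[of "\<lambda>d. to_fract (\<phi> d)" 1] by (simp add: \<phi>_one)
  have neg: "- f \<in> Int_ext \<phi> E" if "f \<in> Int_ext \<phi> E" for f
    using smult[OF that, of "- 1"] by (simp add: \<phi>_neg)
  have zero: "0 \<in> Int_ext \<phi> E" using add[OF one neg[OF one]] by simp
  have inv: "the_inv (\<lambda>d. to_fract (\<phi> d)) (to_fract (\<phi> d)) = d" for d
    using inj by (intro the_inv_f_f) (simp add: inj_def)
  have ev: "\<exists>d. poly (fract_poly f) (fract_map \<phi> e) = to_fract (\<phi> d)" if "f \<in> Int_ext \<phi> E" for f
    using that e by (auto simp: Int_ext_def)
  have "abelian_group (Int_ext_module \<phi> E)"
    by (rule abelian_groupI)
      (auto simp: Int_ext_module_def add zero algebra_simps intro!: bexI[of _ "- _"] neg)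
  then have "Module.module ring_of_type_algebra (Int_ext_module \<phi> E)"
    by (intro moduleI cring_from_type_algebra)
      (auto simp: Int_ext_module_def ring_of_type_algebra_simps smult \<phi>_add \<phi>_mult \<phi>_one
        smult_add_left smult_add_right)
  then show ?thesis
  proof (intro unimodular_module.intro unimodular_module_axioms.intro)
    fix f g assume "f \<in> carrier (Int_ext_module \<phi> E)" "g \<in> carrier (Int_ext_module \<phi> E)"
    then have "f \<in> Int_ext \<phi> E" "g \<in> Int_ext \<phi> E" by (simp_all add: Int_ext_module_def)
    from ev[OF this(1)] ev[OF this(2)]
    show "the_inv (\<lambda>d. to_fract (\<phi> d)) (poly (fract_poly (f \<oplus>\<^bsub>Int_ext_module \<phi> E\<^esub> g)) (fract_map \<phi> e)) =
        the_inv (\<lambda>d. to_fract (\<phi> d)) (poly (fract_poly f) (fract_map \<phi> e)) \<oplus>\<^bsub>ring_of_type_algebra\<^esub>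
        the_inv (\<lambda>d. to_fract (\<phi> d)) (poly (fract_poly g) (fract_map \<phi> e))"
      by (auto simp: Int_ext_module_def ring_of_type_algebra_simps inv
          simp flip: to_fract_add \<phi>_add)
  next
    fix d f assume "f \<in> carrier (Int_ext_module \<phi> E)"
    then have "f \<in> Int_ext \<phi> E" by (simp add: Int_ext_module_def)
    from ev[OF this]
    show "the_inv (\<lambda>d. to_fract (\<phi> d)) (poly (fract_poly (d \<odot>\<^bsub>Int_ext_module \<phi> E\<^esub> f)) (fract_map \<phi> e)) =
        d \<otimes>\<^bsub>ring_of_type_algebra\<^esub> the_inv (\<lambda>d. to_fract (\<phi> d)) (poly (fract_poly f) (fract_map \<phi> e))"
      by (auto simp: Int_ext_module_def ring_of_type_algebra_simps inv
          simp flip: to_fract_mult \<phi>_mult)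
  qed (use one inv[of 1] in \<open>simp_all add: Int_ext_module_def ring_of_type_algebra_simps \<phi>_one\<close>)
qed

theorem theorem4p5:
  fixes \<phi> :: "'d::idom \<Rightarrow> 'b::idom" and E :: "'d fract set"
  assumes "\<phi> \<in> ring_hom ring_of_type_algebra ring_of_type_algebra" and "inj \<phi>"
    and "E \<noteq> {}"
  shows "(flat_module TYPE('n) ring_of_type_algebra (Int_R_module E) \<longleftrightarrow>
          faithfully_flat_module TYPE('n) ring_of_type_algebra (Int_R_module E))
       \<and> (flat_module TYPE('n) ring_of_type_algebra (Int_ext_module \<phi> E) \<longleftrightarrow>
          faithfully_flat_module TYPE('n) ring_of_type_algebra (Int_ext_module \<phi> E))"
proof -
  obtain e where "e \<in> E" using assms(3) by blast
  then show ?thesis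
    using unimodular_module.flat_iff_faithfully_flat[OF unimodular_Int_R_module]
      unimodular_module.flat_iff_faithfully_flat[OF unimodular_Int_ext_module[OF assms(1,2)]]
    by blast
qed

end
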